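(* Let $\beta(n)$ be the number of bubbles of length $n$, of arbitrary width $r\ge 2$ and arbitrary height. Then, as formal power series, $$\sum_{n\ge 0}\beta(n)q^n=\frac{1}{2q}\left(1-q-q^2-q^3-q^4-q^5-\sqrt{(1+q)(1+q+q^2)(1-q+q^2)(1-q-q^2)(1-2q-q^3)}\right),$$ where $\sqrt{\cdot}$ denotes the formal power series square root with constant term $1$.
   Context: Cells are unit squares of the square lattice, adjacent when they share an edge. A snake of length $n$ is an edge-connected set of $n$ cells (up to translation) whose adjacency graph has no cycle and all degrees at most two (so it is a path). It is a partially directed snake (PDS) if its cells can be listed $c_1,\dots,c_n$ from one end (tail) to the other (head) with every step North, East or West. A bubble of width $r\ge 2$ is a PDS whose tail $c_1$ and head $c_n$ lie in one and the same column, called column $1$, all of whose other cells lie in columns $2,\dots,r$ (columns numbered from left to right, so tail and head are on the left), and which has at least one cell in column $r$. *)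

theory Defs
  imports
    Complex_Main
    "HOL-Library.Product_Plus"
    "HOL-Computational_Algebra.Formal_Power_Series"
begin

text \<open>A cell is the unit square with lower left corner \<open>(x, y)\<close>: column \<open>x\<close>, row \<open>y\<close>.\<close>

type_synonym cell = "int \<times> int"

definition adjacent :: "cell \<Rightarrow> cell \<Rightarrow> bool" where
  "adjacent c d \<longleftrightarrow> \<bar>fst c - fst d\<bar> + \<bar>snd c - snd d\<bar> = 1"

definition edge_connected :: "cell set \<Rightarrow> bool" where
  "edge_connected S \<longleftrightarrow>
     (\<forall>c\<in>S. \<forall>d\<in>S. (c, d) \<in> {(a, b). a \<in> S \<and> b \<in> S \<and> adjacent a b}\<^sup>*)"

definition has_cycle :: "cell set \<Rightarrow> bool" where
  "has_cycle S \<longleftrightarrow>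
     (\<exists>cs. length cs \<ge> 3 \<and> distinct cs \<and> set cs \<subseteq> S \<and>
           successively adjacent cs \<and> adjacent (last cs) (hd cs))"

text \<open>The length of a snake is its number of cells.\<close>

definition snake :: "cell set \<Rightarrow> bool" where
  "snake S \<longleftrightarrow>
     finite S \<and> S \<noteq> {} \<and> edge_connected S \<and> \<not> has_cycle S \<and>
     (\<forall>c\<in>S. card {d \<in> S. adjacent c d} \<le> 2)"

definition step_NEW :: "cell \<Rightarrow> cell \<Rightarrow> bool" where
  "step_NEW c d \<longleftrightarrow> d - c \<in> {(0, 1), (1, 0), (- 1, 0)}"

text \<open>
  Since the adjacency graph of a snake is a path, a listing of all cells, without repetition,
  in which consecutive cells are adjacent necessarily runs from one end to the other.
\<close>

definition pds_listing :: "cell set \<Rightarrow> cell list \<Rightarrow> bool" where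
  "pds_listing S cs \<longleftrightarrow>
     snake S \<and> set cs = S \<and> distinct cs \<and> successively step_NEW cs"

definition pds :: "cell set \<Rightarrow> bool" where
  "pds S \<longleftrightarrow> (\<exists>cs. pds_listing S cs)"

text \<open>
  Columns are numbered from left to right so that the column of the tail \<open>t\<close> has number 1;
  in this way the notion of a bubble is invariant under translation.
\<close>

definition column :: "cell \<Rightarrow> cell \<Rightarrow> int" where
  "column t c = fst c - fst t + 1"

definition bubble :: "nat \<Rightarrow> cell set \<Rightarrow> bool" where
  "bubble r S \<longleftrightarrow>
     r \<ge> 2 \<and> pds S \<and>
     (\<exists>cs. pds_listing S cs \<and>
        (let t = hd cs; h = last cs in
           column t h = 1 \<and>
           (\<forall>c\<in>S - {t, h}. 2 \<le> column t c \<and> column t c \<le> int r) \<and>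
           (\<exists>c\<in>S. column t c = int r)))"

definition translation_rel :: "(cell set \<times> cell set) set" where
  "translation_rel = {(S, T). \<exists>v. T = (+) v ` S}"

lemma equiv_translation_rel: "equiv UNIV translation_rel"
proof (rule equivI)
  show "refl translation_rel"
  proof (rule refl_onI)
    fix S :: "cell set"
    have "S = (+) 0 ` S"
      by simp
    then show "(S, S) \<in> translation_rel"
      unfolding translation_rel_def by blast
  qed
  show "sym translation_rel"
  proof (rule symI)
    fix S T assume "(S, T) \<in> translation_rel"
    then obtain v where "T = (+) v ` S"
      by (auto simp: translation_rel_def)
    then have "S = (+) (- v) ` T"
      by (simp add: image_image)
    then show "(T, S) \<in> translation_rel"
      unfolding translation_rel_def by blast
  qed
  show "trans translation_rel"
  proof (rule transI)
    fix S T U assume "(S, T) \<in> translation_rel" "(T, U) \<in> translation_rel"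
    then obtain v w where "T = (+) v ` S" "U = (+) w ` T"
      by (auto simp: translation_rel_def)
    then have "U = (+) (w + v) ` S"
      by (simp add: image_image add.assoc)
    then show "(S, U) \<in> translation_rel"
      unfolding translation_rel_def by blast
  qed
qed simp

definition bubble_count :: "nat \<Rightarrow> nat" where
  "bubble_count n = card ({S. (\<exists>r. bubble r S) \<and> card S = n} // translation_rel)"

text \<open>
  The square root with constant term 1 of a formal power series with constant term 1 is
  \<^term>\<open>fps_radical root 2\<close>.
\<close>

lemma fps_radical_root_2_unique:
  fixes f g :: "real fps"
  assumes "fps_nth f 0 = 1"
  shows "g = fps_radical root 2 f \<longleftrightarrow> g ^ 2 = f \<and> fps_nth g 0 = 1"
proof -
  have "fps_radical root 2 f ^ 2 = f"
    using power_radical[of f root 1] assms by (simp add: numeral_2_eq_2)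
  moreover have "g = fps_radical root 2 f" if "g ^ 2 = f" "fps_nth g 0 = 1"
    using radical_unique[of root 1 f g] that assms by (simp add: numeral_2_eq_2)
  ultimately show ?thesis
    using assms by auto
qed

end

theory Submission
  imports Defs
begin

text \<open>
  A listing of a snake is a walk without chords, and a walk with steps North, East, West has no
  chord iff it avoids the factors EW, WE, ENW, WNE. Up to translation a bubble is therefore an
  arch: an avoiding word whose horizontal displacement is positive at all proper nonempty prefixes
  and zero at the end. With the generating functions \<open>F\<close> of arches and \<open>M\<close> of nonnegative
  excursions (by number of steps), stripping the first and last step of an arch gives
  \<open>F = q\<^sup>2 (M - 1 - q)\<close>, and splitting off the first arch of an excursion gives
  \<open>M = 1 + q M + F (1 + q + q\<^sup>2 M)\<close>, since two consecutive arches are separated by at least two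
  North steps. Eliminating \<open>M\<close> leaves a quadratic equation for \<open>q F\<close>, the series of the bubbles.
\<close>

section \<open>Snakes as induced paths\<close>

lemma adjacent_sym: "adjacent c d \<longleftrightarrow> adjacent d c"
  unfolding adjacent_def by linarith

text \<open>Encodes a path without chords by what prepending a cell requires, so that the snake
  properties can be proved by induction on the list. The empty list is excluded because a snake has
  at least one cell.\<close>

fun induced_path :: "cell list \<Rightarrow> bool" where
  "induced_path [] \<longleftrightarrow> False"
| "induced_path [c] \<longleftrightarrow> True"
| "induced_path (c # d # cs) \<longleftrightarrow>
     adjacent c d \<and> c \<notin> set (d # cs) \<and> (\<forall>e\<in>set cs. \<not> adjacent c e) \<and> induced_path (d # cs)"

lemma induced_path_distinct: "induced_path cs \<Longrightarrow> distinct cs"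
  by (induction cs rule: induced_path.induct) auto

lemma induced_path_successively: "induced_path cs \<Longrightarrow> successively adjacent cs"
  by (induction cs rule: induced_path.induct) auto

lemma induced_path_not_Nil: "induced_path cs \<Longrightarrow> cs \<noteq> []"
  by auto

lemma has_cycle_mono: "has_cycle S \<Longrightarrow> S \<subseteq> T \<Longrightarrow> has_cycle T"
  unfolding has_cycle_def by (meson subset_trans)

text \<open>A chord from the head to a later cell \<open>e\<close> would close the initial segment
  ending in \<open>e\<close> to a cycle of at least three cells.\<close>

lemma induced_path_if_no_cycle:
  assumes "distinct cs" "successively adjacent cs" "\<not> has_cycle (set cs)" "cs \<noteq> []"
  shows "induced_path cs"
  using assms
proof (induction cs rule: induced_path.induct)
  case (3 c d cs)
  have "\<not> has_cycle (set (d # cs))"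
    using 3(4) has_cycle_mono[of "set (d # cs)" "set (c # d # cs)"] by auto
  then have IH: "induced_path (d # cs)"
    using 3 by auto
  have "\<not> adjacent c e" if in_cs: "e \<in> set cs" for e
  proof
    assume e: "adjacent c e"
    obtain ys zs where cs: "cs = ys @ e # zs"
      using in_cs by (meson split_list)
    let ?ds = "c # d # ys @ [e]"
    have "successively adjacent (?ds @ zs)"
      using 3(3) cs by simp
    then have "successively adjacent ?ds"
      by (metis successively_append_iff)
    moreover have "distinct ?ds" "set ?ds \<subseteq> set (c # d # cs)" "length ?ds \<ge> 3"
      using 3(2) cs by auto
    moreover have "adjacent (last ?ds) (hd ?ds)"
      using e adjacent_sym by simp
    ultimately have "has_cycle (set (c # d # cs))"
      unfolding has_cycle_def by blast
    then show False
      using 3(4) by blast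
  qed
  then show ?case
    using 3 IH by auto
qed auto

text \<open>A cycle has no distinguished start: the closing edge becomes an inner edge after the
  rotation.\<close>

lemma cycle_rotate:
  assumes "successively adjacent (xs @ c # ys)" "adjacent (last (xs @ c # ys)) (hd (xs @ c # ys))"
  shows "successively adjacent (c # ys @ xs)" "adjacent (last (c # ys @ xs)) c"
proof -
  have "successively adjacent ((c # ys) @ xs) \<and> adjacent (last (c # ys @ xs)) c"
  proof (cases "xs = []")
    case False
    have "successively adjacent xs" "successively adjacent (c # ys)" "adjacent (last xs) c"
      using assms(1) False unfolding successively_append_iff by auto
    moreover have "adjacent (last (c # ys)) (hd xs)"
      using assms(2) False by simp
    ultimately show ?thesis
      using False unfolding successively_append_iff by auto
  qed (use assms in simp)
  then show "successively adjacent (c # ys @ xs)" "adjacent (last (c # ys @ xs)) c"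
    by auto
qed

text \<open>The head has only one neighbour on the path, but a cell on a cycle has two. Hence a
  cycle misses the head, and induction applies to the rest of the list.\<close>

lemma induced_path_no_cycle:
  assumes "induced_path cs"
  shows "\<not> has_cycle (set cs)"
  using assms
proof (induction cs rule: induced_path.induct)
  case (2 c)
  have False if "length ds \<ge> 3" "distinct ds" "set ds \<subseteq> {c}" for ds :: "cell list"
  proof -
    have "card (set ds) \<le> card {c}"
      using that by (intro card_mono) auto
    then show False
      using that distinct_card[of ds] by simp
  qed
  then show ?case
    unfolding has_cycle_def by auto
next
  case (3 c d cs)
  show ?case
  proof
    assume "has_cycle (set (c # d # cs))"
    then obtain ds where ds: "length ds \<ge> 3" "distinct ds" "set ds \<subseteq> set (c # d # cs)"
      "successively adjacent ds" "adjacent (last ds) (hd ds)"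
      unfolding has_cycle_def by blast
    show False
    proof (cases "c \<in> set ds")
      case False
      then have "has_cycle (set (d # cs))"
        using ds unfolding has_cycle_def by (intro exI[of _ ds]) auto
      then show False
        using 3 by simp
    next
      case True
      then obtain xs ys where split: "ds = xs @ c # ys"
        by (meson split_list)
      \<comment> \<open>The cycle without \<open>c\<close>, read from the successor of
        \<open>c\<close>; its first and last entries are distinct neighbours of
        \<open>c\<close>.\<close>
      define es where "es = ys @ xs"
      have es: "length es \<ge> 2" "distinct (c # es)" "set es \<subseteq> set (d # cs)"
        using ds split by (auto simp: es_def)
      have "successively adjacent (c # es)" "adjacent (last (c # es)) c"
        using cycle_rotate[of xs c ys] ds split by (auto simp: es_def)
      then have "adjacent c (hd es)" "adjacent c (last es)"
        using es(1) adjacent_sym by (cases es; auto)+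
      moreover have "hd es \<in> set (d # cs)" "last es \<in> set (d # cs)"
        using es by (metis hd_in_set last_in_set length_0_conv not_numeral_le_zero subsetD)+
      ultimately have "hd es = d" "last es = d"
        using 3(2) by auto
      moreover have "hd es \<noteq> last es"
        using es by (cases es) auto
      ultimately show False
        by simp
    qed
  qed
qed auto

text \<open>The bound 1 at the head strengthens the induction: prepending a cell adds one neighbour
  to the old head and none to any other old cell.\<close>

lemma induced_path_degree:
  assumes "induced_path cs" "c \<in> set cs"
  shows "card {d \<in> set cs. adjacent c d} \<le> 2 \<and>
    (c = hd cs \<longrightarrow> card {d \<in> set cs. adjacent c d} \<le> 1)"
  using assms
proof (induction cs arbitrary: c rule: induced_path.induct)
  case (2 c' c)
  then have no_nb: "{d \<in> set [c']. adjacent c d} = {}"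
    by (auto simp: adjacent_def)
  show ?case
    unfolding no_nb by simp
next
  case (3 a b cs c)
  have a: "{d \<in> set (a # b # cs). adjacent a d} \<subseteq> {b}"
    using 3(2) by (auto simp: adjacent_def)
  have IH: "card {d \<in> set (b # cs). adjacent x d} \<le> 2 \<and>
    (x = b \<longrightarrow> card {d \<in> set (b # cs). adjacent x d} \<le> 1)" if "x \<in> set (b # cs)" for x
    using 3 that by simp
  show ?case
  proof (cases "c = a")
    case True
    then show ?thesis
      using card_mono[OF _ a] by simp
  next
    case False
    then have c: "c \<in> set (b # cs)"
      using 3 by simp
    have "card {d \<in> set (a # b # cs). adjacent c d} \<le> 2"
    proof (cases "c = b")
      case True
      have "{d \<in> set (a # b # cs). adjacent c d} \<subseteq> insert a {d \<in> set (b # cs). adjacent c d}"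
        by auto
      then have "card {d \<in> set (a # b # cs). adjacent c d}
          \<le> card (insert a {d \<in> set (b # cs). adjacent c d})"
        by (intro card_mono) auto
      also have "\<dots> \<le> Suc (card {d \<in> set (b # cs). adjacent c d})"
        by (rule card_insert_le_m1) auto
      also have "\<dots> \<le> 2"
        using IH[OF c] True by simp
      finally show ?thesis .
    next
      case False
      then have "\<not> adjacent a c"
        using 3(2) c by auto
      then have "\<not> adjacent c a"
        using adjacent_sym by blast
      then have "{d \<in> set (a # b # cs). adjacent c d} = {d \<in> set (b # cs). adjacent c d}"
        by auto
      then show ?thesis
        using IH[OF c] by simp
    qed
    then show ?thesis
      using False by simp
  qed
qed auto

lemma successively_edge_connected:
  assumes "successively adjacent cs"
  shows "edge_connected (set cs)"
proof -
  let ?R = "\<lambda>S. {(a, b). a \<in> S \<and> b \<in> S \<and> adjacent a b}"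
  have "sym ((?R (set cs))\<^sup>*)"
    by (rule sym_rtrancl) (auto simp: sym_def adjacent_sym)
  moreover have "(hd cs, c) \<in> (?R (set cs))\<^sup>*" if "c \<in> set cs" for c
    using assms that
  proof (induction cs rule: induct_list012)
    case (3 a b cs)
    show ?case
    proof (cases "c = a")
      case False
      then have "(b, c) \<in> (?R (set (b # cs)))\<^sup>*"
        using 3 by auto
      moreover have "(?R (set (b # cs)))\<^sup>* \<subseteq> (?R (set (a # b # cs)))\<^sup>*"
        by (rule rtrancl_mono) auto
      moreover have "(a, b) \<in> ?R (set (a # b # cs))"
        using 3 by auto
      ultimately show ?thesis
        by (metis (no_types, lifting) converse_rtrancl_into_rtrancl list.sel(1) subsetD)
    qed auto
  qed auto
  ultimately show ?thesis
    unfolding edge_connected_def by (meson rtrancl_trans symD)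
qed

lemma induced_path_snake: "induced_path cs \<Longrightarrow> snake (set cs)"
  unfolding snake_def
  using successively_edge_connected[OF induced_path_successively] induced_path_no_cycle
    induced_path_degree induced_path_not_Nil by auto

text \<open>The second cell is the only neighbour of the head in the set, so the set and the
  starting cell determine the list step by step.\<close>

lemma induced_path_unique:
  assumes "induced_path (c # cs)" "induced_path (c # ds)" "set (c # cs) = set (c # ds)"
  shows "cs = ds"
  using assms
proof (induction cs arbitrary: c ds)
  case Nil
  then show ?case
    using induced_path_distinct[of "c # ds"] by (cases ds) auto
next
  case (Cons a cs)
  have dist: "distinct (c # a # cs)" "distinct (c # ds)"
    using Cons.prems induced_path_distinct by blast+
  then have sets: "set (a # cs) = set ds"
    using Cons.prems(3) by auto
  then obtain b ds' where ds: "ds = b # ds'"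
    by (cases ds) auto
  have "a \<in> set ds" "adjacent c a"
    using sets Cons.prems(1) by auto
  then have "a = b"
    using Cons.prems(2) ds by auto
  moreover have "set (a # cs) = set (b # ds')"
    using sets ds by simp
  ultimately have "cs = ds'"
    using Cons.prems ds by (intro Cons.IH[of b]) auto
  then show ?case
    using ds \<open>a = b\<close> by simp
qed

section \<open>Words of steps\<close>

text \<open>A step is encoded by its horizontal displacement: \<open>1\<close> is East, \<open>-1\<close> is West, and \<open>0\<close>
  is North.\<close>

definition step :: "int \<Rightarrow> cell" where
  "step k = (k, if k = 0 then 1 else 0)"

fun trail :: "cell \<Rightarrow> int list \<Rightarrow> cell list" where
  "trail c [] = [c]"
| "trail c (k # w) = c # trail (c + step k) w"

lemma trail_not_Nil [simp]: "trail c w \<noteq> []" "[] \<noteq> trail c w"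
  by (cases w; auto)+

lemma hd_trail [simp]: "hd (trail c w) = c"
  by (cases w) auto

lemma length_trail [simp]: "length (trail c w) = Suc (length w)"
  by (induction w arbitrary: c) auto

lemma fst_trail_nth: "i \<le> length w \<Longrightarrow> fst (trail c w ! i) = fst c + sum_list (take i w)"
proof (induction w arbitrary: c i)
  case (Cons k w)
  then show ?case
    by (cases i) (auto simp: step_def)
qed auto

lemma trail_translate: "trail (v + c) w = map ((+) v) (trail c w)"
  by (induction w arbitrary: c) (auto simp: add.assoc)

lemma trail_inj: "trail c u = trail c w \<Longrightarrow> u = w"
proof (induction u arbitrary: c w)
  case Nil
  then show ?case
    by (cases w) auto
next
  case (Cons k u)
  then obtain j w' where w: "w = j # w'"
    by (cases w) auto
  then have eq: "trail (c + step k) u = trail (c + step j) w'"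
    using Cons by simp
  then have "c + step k = c + step j"
    by (metis hd_trail)
  then have "k = j"
    by (auto simp: step_def)
  then show ?case
    using Cons.IH eq w by auto
qed

lemma trail_of_listing:
  assumes "successively step_NEW cs" "cs \<noteq> []"
  obtains w where "set w \<subseteq> {- 1, 0, 1}" "cs = trail (hd cs) w"
proof -
  have "\<exists>w. set w \<subseteq> {- 1, 0, 1} \<and> cs = trail (hd cs) w"
    using assms
  proof (induction cs rule: induct_list012)
    case (2 c)
    then show ?case
      by (intro exI[of _ "[]"]) auto
  next
    case (3 c d cs)
    then obtain w where w: "set w \<subseteq> {- 1, 0, 1}" "d # cs = trail d w"
      by auto
    have "d - c \<in> {(0, 1), (1, 0), (- 1, 0)}"
      using 3(3) by (simp add: step_NEW_def)
    then have "\<exists>k\<in>{- 1, 0, 1}. d = c + step k"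
      by (cases c; cases d) (auto simp: step_def)
    then obtain k where "k \<in> {- 1, 0, 1}" "d = c + step k"
      by blast
    then show ?case
      using w by (intro exI[of _ "k # w"]) auto
  qed auto
  then show thesis
    using that by blast
qed

lemma trail_step_NEW: "set w \<subseteq> {- 1, 0, 1} \<Longrightarrow> successively step_NEW (trail c w)"
proof (induction w arbitrary: c)
  case (Cons k w)
  have "step_NEW c (c + step k)"
    using Cons.prems by (auto simp: step_NEW_def step_def)
  then show ?case
    using Cons by (auto simp: successively_Cons)
qed auto

text \<open>A trail touches itself exactly when it turns back (\<open>[k, - k]\<close>) or makes a U-turn of
  height one (\<open>[k, 0, - k]\<close>).\<close>

fun admissible :: "int list \<Rightarrow> bool" where
  "admissible [] \<longleftrightarrow> True"
| "admissible (k # w) \<longleftrightarrow> k \<in> {- 1, 0, 1} \<and> admissible w \<and>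
     (k \<noteq> 0 \<longrightarrow> take 1 w \<noteq> [- k] \<and> take 2 w \<noteq> [0, - k])"

lemma admissible_letters: "admissible w \<Longrightarrow> set w \<subseteq> {- 1, 0, 1}"
  by (induction w) auto

section \<open>Admissible words and trails without chords\<close>

lemma trail_rows: "d \<in> set (trail c w) \<Longrightarrow> snd c \<le> snd d"
proof (induction w arbitrary: c)
  case (Cons k w)
  show ?case
  proof (cases "d = c")
    case False
    then have "snd (c + step k) \<le> snd d"
      using Cons.prems by (intro Cons.IH) auto
    then show ?thesis
      by (simp add: step_def split: if_splits)
  qed auto
qed auto

text \<open>Here \<open>c\<close> is the cell reached by the step \<open>k\<close>. While the trail
  stays in this row it can only repeat \<open>k\<close>, since turning back is forbidden and a North
  step leaves the row for good.\<close>

lemma trail_same_row: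
  assumes "admissible (k # w)" "k \<noteq> 0" "d \<in> set (trail c w)" "snd d = snd c"
  shows "k * (fst d - fst c) \<ge> 0"
  using assms
proof (induction w arbitrary: c)
  case (Cons j w)
  have k: "k = 1 \<or> k = - 1" and j: "j \<in> {0, k}"
    using Cons.prems by auto
  show ?case
  proof (cases "d = c")
    case False
    then have d: "d \<in> set (trail (c + step j) w)"
      using Cons by auto
    have "j \<noteq> 0"
      using trail_rows[OF d] Cons.prems by (auto simp: step_def)
    then have "j = k"
      using j by simp
    then have "k * (fst d - fst (c + step k)) \<ge> 0"
      using Cons d by (intro Cons.IH) (auto simp: step_def)
    then show ?thesis
      using k by (auto simp: step_def)
  qed auto
qed auto

text \<open>The trail moves on in direction \<open>k\<close> until its first North step; after that
  the forbidden factor \<open>[k, 0, - k]\<close> makes the next row run in direction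
  \<open>k\<close> as well.\<close>

lemma trail_next_row:
  assumes "admissible (k # w)" "k \<noteq> 0" "d \<in> set (trail c w)" "snd d = snd c + 1"
  shows "k * (fst d - fst c) \<ge> 0"
  using assms
proof (induction w arbitrary: c)
  case (Cons j w)
  have k: "k = 1 \<or> k = - 1" and j: "j \<in> {0, k}"
    using Cons.prems by auto
  have d: "d \<in> set (trail (c + step j) w)"
    using Cons by auto
  show ?case
  proof (cases "j = k")
    case True
    then have "k * (fst d - fst (c + step k)) \<ge> 0"
      using Cons d by (intro Cons.IH) (auto simp: step_def)
    then show ?thesis
      using k by (auto simp: step_def)
  next
    case False
    then have j0: "j = 0"
      using j by simp
    show ?thesis
    proof (cases "d = c + step 0")
      case False
      then obtain i w' where w: "w = i # w'"
        using d j0 by (cases w) auto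
      then have d': "d \<in> set (trail (c + step 0 + step i) w')"
        using d j0 False by auto
      have "i \<noteq> 0"
        using trail_rows[OF d'] Cons.prems by (auto simp: step_def)
      then have "i = k"
        using Cons.prems w j0 by (auto simp: numeral_2_eq_2)
      then have "k * (fst d - fst (c + step 0 + step k)) \<ge> 0"
        using Cons.prems w d' by (intro trail_same_row[of k w']) (auto simp: step_def)
      then show ?thesis
        using k by (auto simp: step_def)
    qed (auto simp: step_def)
  qed
qed auto

text \<open>Later cells are never lower than \<open>c\<close>. After a horizontal step
  \<open>k\<close>, the two preceding bounds keep all later cells in the row of \<open>c\<close> and
  in the row above strictly beyond \<open>c\<close> in direction \<open>k\<close>, so that only
  \<open>c'\<close> touches \<open>c\<close>.\<close>

lemma induced_path_trail: "admissible w \<Longrightarrow> induced_path (trail c w)"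
proof (induction w arbitrary: c)
  case (Cons k w)
  define c' where "c' = c + step k"
  have k: "k \<in> {- 1, 0, 1}" and IH: "induced_path (trail c' w)"
    using Cons by auto
  obtain cs where cs: "trail c' w = c' # cs"
    by (metis hd_trail list.collapse trail_not_Nil)
  have "c \<notin> set (trail c' w) \<and> (\<forall>e\<in>set cs. \<not> adjacent c e)"
  proof (cases "k = 0")
    case True
    \<comment> \<open>After a North step all later cells lie above \<open>c\<close>, and among these
      only \<open>c'\<close>, directly above, can be adjacent to \<open>c\<close>.\<close>
    have "snd c + 1 \<le> snd e" if "e \<in> set (trail c' w)" for e
      using trail_rows[OF that] True by (simp add: c'_def step_def)
    moreover have "e \<noteq> c'" if "e \<in> set cs" for e
      using induced_path_distinct[OF IH] cs that by auto
    ultimately show ?thesis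
      using True unfolding cs
      by (fastforce simp: adjacent_def c'_def step_def prod_eq_iff)
  next
    case False
    have main: "c \<noteq> e \<and> (adjacent c e \<longrightarrow> e = c')" if e: "e \<in> set (trail c' w)" for e
    proof -
      have "snd c \<le> snd e"
        using trail_rows[OF e] False by (simp add: c'_def step_def)
      then consider "snd e = snd c" | "snd e = snd c + 1" | "snd c + 2 \<le> snd e"
        by linarith
      then show ?thesis
      proof cases
        case 1
        then have "k * (fst e - fst c - k) \<ge> 0"
          using trail_same_row[of k w e c'] Cons.prems False e
          by (simp add: c'_def step_def algebra_simps)
        then show ?thesis
          using 1 False k by (cases c; cases e) (auto simp: adjacent_def c'_def step_def)
      next
        case 2
        then have "k * (fst e - fst c - k) \<ge> 0"
          using trail_next_row[of k w e c'] Cons.prems False e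
          by (simp add: c'_def step_def algebra_simps)
        then show ?thesis
          using 2 False k by (cases c; cases e) (auto simp: adjacent_def c'_def step_def)
      next
        case 3
        then show ?thesis
          by (cases c; cases e) (auto simp: adjacent_def)
      qed
    qed
    have "c \<notin> set (trail c' w)"
      using main by blast
    moreover have "\<not> adjacent c e" if "e \<in> set cs" for e
      using main[of e] induced_path_distinct[OF IH] cs that by auto
    ultimately show ?thesis
      by blast
  qed
  moreover have "adjacent c c'"
    using k by (auto simp: adjacent_def c'_def step_def)
  ultimately show ?case
    using IH cs by (simp add: c'_def)
qed auto

text \<open>The factor \<open>[k, - k]\<close> revisits its starting cell, and
  \<open>[k, 0, - k]\<close> ends directly above it, which is a chord.\<close>

lemma admissible_if_induced_path:
  assumes "induced_path (trail c w)" "set w \<subseteq> {- 1, 0, 1}"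
  shows "admissible w"
  using assms
proof (induction w arbitrary: c)
  case (Cons k w)
  obtain cs where cs: "trail (c + step k) w = (c + step k) # cs"
    by (metis hd_trail list.collapse trail_not_Nil)
  have ip: "induced_path (c # (c + step k) # cs)"
    using Cons.prems cs by simp
  have "admissible w"
    using Cons.prems(2) ip cs by (intro Cons.IH[of "c + step k"]) auto
  moreover have "take 1 w \<noteq> [- k]" if "k \<noteq> 0"
  proof
    assume "take 1 w = [- k]"
    then obtain w' where "w = - k # w'"
      by (cases w) auto
    then have "hd cs = c" "cs \<noteq> []"
      using cs that by (auto simp: step_def prod_eq_iff)
    then show False
      using ip by (metis hd_in_set induced_path.simps(3) list.set_intros(2))
  qed
  moreover have "take 2 w \<noteq> [0, - k]" if "k \<noteq> 0"
  proof
    assume "take 2 w = [0, - k]"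
    then obtain w' where "w = 0 # - k # w'"
      by (cases w; cases "tl w") auto
    then have "cs = (c + step k + step 0) # trail (c + step k + step 0 + step (- k)) w'"
      using cs by simp
    moreover have "c + step k + step 0 + step (- k) \<in> set (trail (c + step k + step 0 + step (- k)) w')"
      by (metis hd_in_set hd_trail trail_not_Nil)
    ultimately have "c + step k + step 0 + step (- k) \<in> set cs"
      by simp
    then have "\<not> adjacent c (c + step k + step 0 + step (- k))"
      using ip by simp
    then show False
      using that by (simp add: adjacent_def step_def)
  qed
  ultimately show ?case
    using Cons.prems by auto
qed auto

section \<open>Forbidden factors under splitting and concatenation\<close>

lemma admissible_appendD:
  assumes "admissible (u @ v)"
  shows "admissible u" "admissible v"
proof -
  show "admissible u"
    using assms
  proof (induction u)
    case (Cons k u)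
    then show ?case
      by (cases u; cases "tl u") auto
  qed auto
  show "admissible v"
    using assms by (induction u) auto
qed

text \<open>Between the two ends of a forbidden factor only 0 can occur, so no forbidden factor
  extends across a nonzero letter.\<close>

lemma admissible_append_Cons:
  assumes "k \<noteq> 0"
  shows "admissible (u @ k # v) \<longleftrightarrow> admissible (u @ [k]) \<and> admissible (k # v)"
proof (induction u)
  case (Cons j u)
  have "take 1 (u @ k # v) = take 1 (u @ [k])"
    by (cases u) auto
  moreover have "take 2 (u @ k # v) = [0, - j] \<longleftrightarrow> take 2 (u @ [k]) = [0, - j]"
    using assms by (cases u; cases "tl u") (auto simp: numeral_2_eq_2)
  ultimately show ?case
    using Cons by auto
qed auto

text \<open>A forbidden factor created by the new letter must be a suffix, so only the last two
  letters of \<open>v\<close> matter.\<close>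

lemma admissible_snoc:
  assumes "admissible v" "k \<in> {- 1, 1}" "\<And>u. v \<noteq> u @ [- k]" "\<And>u. v \<noteq> u @ [- k, 0]"
  shows "admissible (v @ [k])"
  using assms
proof (induction v)
  case (Cons j v)
  have "v \<noteq> u @ [- k]" "v \<noteq> u @ [- k, 0]" for u
    using Cons.prems(3,4)[of "j # u"] by auto
  then have "admissible (v @ [k])"
    using Cons by simp
  moreover have "take 1 (v @ [k]) \<noteq> [- j]" if "j \<noteq> 0"
    using Cons.prems(1) Cons.prems(3)[of "[]"] that by (cases v) auto
  moreover have "take 2 (v @ [k]) \<noteq> [0, - j]" if "j \<noteq> 0"
    using Cons.prems(1) Cons.prems(4)[of "[]"] that
    by (cases v; cases "tl v") (auto simp: numeral_2_eq_2)
  ultimately show ?case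
    using Cons.prems(1) by auto
qed auto

section \<open>Excursions and arches\<close>

text \<open>Reading horizontal displacement as height and North as a level step, these are Motzkin
  paths with forbidden factors.\<close>

definition excursions :: "int list set" where
  "excursions = {w. admissible w \<and> sum_list w = 0 \<and> (\<forall>i. 0 \<le> sum_list (take i w))}"

text \<open>The words \<open>[]\<close> and \<open>[0]\<close> meet all the other conditions; the
  length bound keeps them out, as they never leave column 1.\<close>

definition arches :: "int list set" where
  "arches = {w. admissible w \<and> sum_list w = 0 \<and> 2 \<le> length w \<and>
     (\<forall>i. 0 < i \<and> i < length w \<longrightarrow> 0 < sum_list (take i w))}"

definition conc :: "int list set \<Rightarrow> int list set \<Rightarrow> int list set" where
  "conc A B = (\<lambda>(u, v). u @ v) ` (A \<times> B)"

lemma concI: "u \<in> A \<Longrightarrow> v \<in> B \<Longrightarrow> u @ v \<in> conc A B"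
  unfolding conc_def by auto

lemma excursions_Nil: "[] \<in> excursions"
  by (simp add: excursions_def)

lemma excursions_zero_Cons: "0 # w \<in> excursions \<longleftrightarrow> w \<in> excursions"
proof -
  have "(\<forall>i. 0 \<le> sum_list (take i (0 # w))) \<longleftrightarrow> (\<forall>i. 0 \<le> sum_list (take i w))"
    by (metis add_0 sum_list.Cons take_Suc_Cons take_0 sum_list.Nil le_refl not0_implies_Suc)
  then show ?thesis
    by (auto simp: excursions_def)
qed

lemma excursions_Cons_nonneg:
  assumes "k # w \<in> excursions"
  shows "k \<in> {0, 1}"
proof -
  have "0 \<le> sum_list (take 1 (k # w))" "admissible (k # w)"
    using assms unfolding excursions_def by blast+
  then show ?thesis
    by auto
qed

text \<open>An arch must open with East and close with West, and in between the displacement is at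
  least 1, so the interior is an excursion one column to the right. The interiors \<open>[]\<close>
  and \<open>[0]\<close> would give the forbidden EW and ENW.\<close>

lemma arches_eq:
  "arches = conc {[1]} (conc (excursions - {[], [0]}) {[- 1]})" (is "_ = ?R")
proof (intro equalityI subsetI)
  fix w assume w: "w \<in> arches"
  obtain k w' where "w = k # w'" "w' \<noteq> []"
    using w by (cases w; cases "tl w") (auto simp: arches_def)
  then obtain v l where kvl: "w = k # v @ [l]"
    by (metis rev_exhaust)
  have pos: "0 < sum_list (take i w)" if "0 < i" "i < length w" for i
    using w that by (auto simp: arches_def)
  have adm: "admissible w" and sum: "sum_list w = 0"
    using w by (auto simp: arches_def)
  have "set w \<subseteq> {- 1, 0, 1}"
    using admissible_letters[OF adm] .
  then have k: "k = 1" and l: "l = - 1"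
    using pos[of 1] pos[of "Suc (length v)"] sum kvl by auto
  have "admissible v"
    using adm kvl admissible_appendD[of "[k]" "v @ [l]"] admissible_appendD[of v "[l]"] by simp
  moreover have "sum_list v = 0"
    using sum kvl k l by simp
  moreover have "0 \<le> sum_list (take i v)" for i
  proof (cases "i \<le> length v")
    case True
    then show ?thesis
      using pos[of "Suc i"] kvl k by auto
  next
    case False
    then show ?thesis
      using \<open>sum_list v = 0\<close> by simp
  qed
  moreover have "v \<notin> {[], [0]}"
    using adm kvl k l by auto
  ultimately have "v \<in> excursions - {[], [0]}"
    by (auto simp: excursions_def)
  then have "[1] @ (v @ [- 1]) \<in> ?R"
    by (intro concI) auto
  then show "w \<in> ?R"
    using kvl k l by simp
next
  fix w assume "w \<in> ?R"
  then have "\<exists>v. v \<in> excursions \<and> v \<noteq> [] \<and> v \<noteq> [0] \<and> w = 1 # v @ [- 1]"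
    by (auto simp: conc_def)
  then obtain v where v: "v \<in> excursions" "v \<noteq> []" "v \<noteq> [0]" and w: "w = 1 # v @ [- 1]"
    by blast
  have adm: "admissible v" and sum: "sum_list v = 0"
    and nonneg: "\<And>i. 0 \<le> sum_list (take i v)"
    using v by (auto simp: excursions_def)
  \<comment> \<open>An excursion cannot end in \<open>[1]\<close> or \<open>[1, 0]\<close>, since
    the displacement before that ending would be -1; likewise it cannot begin with
    \<open>[- 1]\<close> or \<open>[0, - 1]\<close>. Hence the two end steps create no forbidden
    factor.\<close>
  have "v \<noteq> u @ [1]" for u
    using nonneg[of "length u"] sum by auto
  moreover have "v \<noteq> u @ [1, 0]" for u
    using nonneg[of "length u"] sum by auto
  ultimately have "admissible (v @ [- 1])"
    using adm by (intro admissible_snoc) auto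
  moreover have "take 1 (v @ [- 1]) \<noteq> [- 1]"
    using v nonneg[of 1] by (cases v) auto
  moreover have "take 2 (v @ [- 1]) \<noteq> [0, - 1]"
    using v nonneg[of 2] by (cases v; cases "tl v") (auto simp: numeral_2_eq_2)
  ultimately have "admissible w"
    using w by simp
  moreover have "0 < sum_list (take i w)" if "0 < i" "i < length w" for i
  proof (cases i)
    case (Suc j)
    then show ?thesis
      using w that nonneg[of j] by auto
  qed (use that in simp)
  ultimately show "w \<in> arches"
    using w sum by (simp add: arches_def)
qed

text \<open>An arch ends with West, so by \<open>admissible_append_Cons\<close> only the letters
  right after that step can create a forbidden factor.\<close>

lemma arches_admissible_append:
  assumes "a \<in> arches"
  shows "admissible (a @ v) \<longleftrightarrow> admissible v \<and> take 1 v \<noteq> [1] \<and> take 2 v \<noteq> [0, 1]"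
proof -
  obtain u where a: "a = u @ [- 1]"
    using assms unfolding arches_eq by (auto simp: conc_def)
  have "admissible (u @ [- 1])"
    using assms a by (simp add: arches_def)
  then show ?thesis
    using admissible_append_Cons[of "- 1" u v] a by simp
qed

text \<open>What may follow an arch inside an excursion.\<close>

definition arch_rests :: "int list set" where
  "arch_rests = {[]} \<union> ({[0]} \<union> conc {[0, 0]} excursions)"

text \<open>A nonempty excursion opens with 0 or 1, and removing a leading 0 leaves an excursion.
  With E and NE ruled out, a rest of length at least two must therefore open with two North
  steps.\<close>

lemma arch_rests_eq:
  "arch_rests = {v \<in> excursions. take 1 v \<noteq> [1] \<and> take 2 v \<noteq> [0, 1]}" (is "_ = ?R")
proof (intro equalityI subsetI)
  fix v assume v: "v \<in> ?R"
  then have exc: "v \<in> excursions"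
    by simp
  show "v \<in> arch_rests"
  proof (cases v)
    case (Cons k v')
    then have k: "k = 0"
      using v excursions_Cons_nonneg[of k v'] by auto
    then have v': "v' \<in> excursions"
      using exc Cons excursions_zero_Cons by simp
    show ?thesis
    proof (cases v')
      case (Cons j v'')
      then have j: "j = 0"
        using v v' \<open>v = k # v'\<close> k excursions_Cons_nonneg[of j v''] by auto
      then have "v'' \<in> excursions"
        using v' Cons excursions_zero_Cons by simp
      then have "[0, 0] @ v'' \<in> conc {[0, 0]} excursions"
        by (intro concI) auto
      then show ?thesis
        using Cons \<open>v = k # v'\<close> k j by (simp add: arch_rests_def)
    qed (simp add: arch_rests_def Cons k)
  qed (simp add: arch_rests_def)
next
  fix v assume "v \<in> arch_rests"
  then show "v \<in> ?R"
    by (auto simp: arch_rests_def conc_def excursions_zero_Cons excursions_Nil)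
qed

lemma sum_take_append_arch:
  assumes "a \<in> arches" "\<And>i. 0 \<le> sum_list (take i v)"
  shows "0 \<le> sum_list (take i (a @ v))"
proof -
  have "0 \<le> sum_list (take i a)"
    using assms(1) by (cases "i = 0"; cases "i < length a") (auto simp: arches_def intro: less_imp_le)
  then show ?thesis
    using assms(2)[of "i - length a"] by simp
qed

text \<open>An initial East step starts an arch, which ends at the first return to displacement
  zero. What follows is again an excursion, restricted only by the West step before it.\<close>

lemma excursions_eq:
  "excursions = {[]} \<union> (conc {[0]} excursions \<union> conc arches arch_rests)" (is "_ = ?R")
proof (intro equalityI subsetI)
  fix w assume w: "w \<in> excursions"
  show "w \<in> ?R"
  proof (cases w)
    case (Cons k w')
    show ?thesis
    proof (cases "k = 0")
      case True
      then have "[0] @ w' \<in> conc {[0]} excursions"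
        using w Cons excursions_zero_Cons by (intro concI) auto
      then show ?thesis
        using Cons True by simp
    next
      case False
      then have k: "k = 1"
        using w Cons excursions_Cons_nonneg by auto
      have adm: "admissible w" and sum: "sum_list w = 0"
        and nonneg: "\<And>i. 0 \<le> sum_list (take i w)"
        using w by (auto simp: excursions_def)
      \<comment> \<open>The least index satisfying \<open>P\<close> is the first return to
        displacement zero, hence the length of the first arch.\<close>
      define P where "P i \<longleftrightarrow> 0 < i \<and> sum_list (take i w) = 0" for i
      define m where "m = (LEAST i. P i)"
      have "P (length w)"
        using sum Cons by (simp add: P_def)
      then have m: "P m" "m \<le> length w"
        unfolding m_def by (rule LeastI, rule Least_le)
      have "m \<noteq> 1"
        using m Cons k by (auto simp: P_def)
      then have "2 \<le> m"
        using m by (simp add: P_def)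
      have pos: "0 < sum_list (take i w)" if "0 < i" "i < m" for i
        using not_less_Least[of i P] that nonneg[of i] by (simp add: m_def P_def)
      have split: "take m w @ drop m w = w"
        by simp
      have "take m w \<in> arches"
        using admissible_appendD(1)[of "take m w" "drop m w"] adm m \<open>2 \<le> m\<close> pos
        by (auto simp: arches_def P_def min_def)
      moreover have "drop m w \<in> excursions"
      proof -
        have "sum_list (take i (drop m w)) = sum_list (take (m + i) w)" for i
          using m by (simp add: take_add P_def)
        moreover have "sum_list (drop m w) = 0"
          using arg_cong[OF split, of sum_list] sum m unfolding sum_list_append P_def by simp
        ultimately show ?thesis
          using nonneg admissible_appendD(2)[of "take m w" "drop m w"] adm
          by (simp add: excursions_def)
      qed
      ultimately have "take m w @ drop m w \<in> conc arches arch_rests"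
        using arches_admissible_append[of "take m w" "drop m w"] adm
        by (intro concI) (auto simp: arch_rests_eq)
      then show ?thesis
        by simp
    qed
  qed auto
next
  fix w assume "w \<in> ?R"
  then consider "w = []" | v where "w = 0 # v" "v \<in> excursions"
    | a v where "w = a @ v" "a \<in> arches" "v \<in> arch_rests"
    by (auto simp: conc_def)
  then show "w \<in> excursions"
  proof cases
    case 3
    then show ?thesis
      using arches_admissible_append[of a v] sum_take_append_arch[of a v]
      by (simp add: arch_rests_eq excursions_def arches_def del: take_append)
  qed (auto simp: excursions_Nil excursions_zero_Cons)
qed

text \<open>If one arch were a proper prefix of another, the longer one would have displacement zero
  at an inner point. This makes the first-arch factorization unambiguous.\<close>

lemma arches_prefix_free:
  assumes "a \<in> arches" "b \<in> arches" "a @ u = b @ v"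
  shows "a = b"
proof -
  have not_less: "\<not> length x < length y"
    if "x \<in> arches" "y \<in> arches" "x @ u = y @ v" for x y u v :: "int list"
  proof
    assume less: "length x < length y"
    then have "take (length x) y = x"
      using that(3) by (metis append_eq_conv_conj less_imp_le take_all_iff take_append
          append_Nil2 diff_is_0_eq take_0)
    moreover have "0 < length x" "sum_list x = 0"
      using that(1) by (auto simp: arches_def)
    moreover have "0 < sum_list (take (length x) y)"
      using that(2) less \<open>0 < length x\<close> by (simp add: arches_def)
    ultimately show False
      by simp
  qed
  have "length a = length b"
    using not_less[OF assms] not_less[OF assms(2,1) assms(3)[symmetric]] by linarith
  then show ?thesis
    using assms by simp
qed

section \<open>Generating functions of languages\<close>

text \<open>Words are weighted by their number of steps, one less than the number of cells of the
  trail.\<close>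

definition lang_fps :: "int list set \<Rightarrow> real fps" where
  "lang_fps A = Abs_fps (\<lambda>n. real (card {w \<in> A. length w = n}))"

text \<open>Guards against the value 0 that \<open>card\<close> gives to infinite sets, which would
  spoil the sum and product rules.\<close>

definition finitary :: "int list set \<Rightarrow> bool" where
  "finitary A \<longleftrightarrow> (\<forall>n. finite {w \<in> A. length w = n})"

lemma finitary_letters:
  assumes "\<And>w. w \<in> A \<Longrightarrow> set w \<subseteq> {- 1, 0, 1}"
  shows "finitary A"
proof -
  have "finite {w \<in> A. length w = n}" for n
    by (rule finite_subset[OF _ finite_lists_length_eq[of "{- 1, 0, 1}" n]]) (use assms in auto)
  then show ?thesis
    by (simp add: finitary_def)
qed

lemma finitary_subset:
  assumes "finitary B" "A \<subseteq> B"
  shows "finitary A"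
proof -
  have "finite {w \<in> A. length w = n}" for n
    by (rule finite_subset[of _ "{w \<in> B. length w = n}"]) (use assms in \<open>auto simp: finitary_def\<close>)
  then show ?thesis
    by (simp add: finitary_def)
qed

lemma lang_fps_single: "lang_fps {w} = fps_X ^ length w"
proof -
  have "{v \<in> {w}. length v = n} = (if n = length w then {w} else {})" for n
    by auto
  then show ?thesis
    by (auto simp: lang_fps_def fps_eq_iff fps_X_power_nth)
qed

lemma lang_fps_Un:
  assumes "finitary A" "finitary B" "A \<inter> B = {}"
  shows "lang_fps (A \<union> B) = lang_fps A + lang_fps B"
proof -
  have "card {w \<in> A \<union> B. length w = n}
      = card {w \<in> A. length w = n} + card {w \<in> B. length w = n}" for n
  proof -
    have "{w \<in> A \<union> B. length w = n} = {w \<in> A. length w = n} \<union> {w \<in> B. length w = n}"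
      by auto
    then show ?thesis
      using assms by (auto simp: finitary_def intro!: card_Un_disjoint)
  qed
  then show ?thesis
    by (simp add: lang_fps_def fps_eq_iff)
qed

lemma conc_slice:
  "{w \<in> conc A B. length w = n} = (\<lambda>(u, v). u @ v) `
     (\<Union>i\<in>{0..n}. {w \<in> A. length w = i} \<times> {w \<in> B. length w = n - i})" (is "?L = ?f ` ?U")
proof (intro equalityI subsetI)
  fix w assume "w \<in> ?L"
  then obtain u v where "u \<in> A" "v \<in> B" "w = u @ v" "length u + length v = n"
    by (auto simp: conc_def)
  then have "(u, v) \<in> ?U" "w = ?f (u, v)"
    by auto
  then show "w \<in> ?f ` ?U"
    by blast
qed (auto simp: conc_def)

lemma finitary_conc:
  assumes "finitary A" "finitary B"
  shows "finitary (conc A B)"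
  using assms unfolding finitary_def conc_slice
  by (intro allI finite_imageI finite_UN_I finite_cartesian_product) simp_all

text \<open>Injectivity makes the splitting of each word unique; sorting by the length of the first
  factor then gives the Cauchy product.\<close>

lemma lang_fps_conc:
  assumes "finitary A" "finitary B" and inj: "inj_on (\<lambda>(u, v). u @ v) (A \<times> B)"
  shows "lang_fps (conc A B) = lang_fps A * lang_fps B"
proof -
  have "card {w \<in> conc A B. length w = n}
      = (\<Sum>i=0..n. card {w \<in> A. length w = i} * card {w \<in> B. length w = n - i})" for n
  proof -
    let ?U = "\<Union>i\<in>{0..n}. {w \<in> A. length w = i} \<times> {w \<in> B. length w = n - i}"
    have "card {w \<in> conc A B. length w = n} = card ?U"
      unfolding conc_slice by (rule card_image, rule inj_on_subset[OF inj]) auto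
    also have "\<dots> = (\<Sum>i=0..n. card ({w \<in> A. length w = i} \<times> {w \<in> B. length w = n - i}))"
      using assms by (intro card_UN_disjoint) (auto simp: finitary_def)
    finally show ?thesis
      by (simp add: card_cartesian_product)
  qed
  then show ?thesis
    by (simp add: lang_fps_def fps_eq_iff fps_mult_nth)
qed

section \<open>Functional equations for excursions and arches\<close>

lemma finitary_excursions: "finitary excursions"
  by (rule finitary_letters) (auto simp: excursions_def dest: admissible_letters)

lemma finitary_arches: "finitary arches"
  by (rule finitary_letters) (auto simp: arches_def dest: admissible_letters)

lemma finitary_single: "finitary {w}"
  by (auto simp: finitary_def)

text \<open>The two end steps contribute \<open>fps_X ^ 2\<close>; the subtracted terms are the
  excluded interiors \<open>[]\<close> and \<open>[0]\<close>.\<close>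

lemma lang_fps_arches:
  "lang_fps arches = fps_X ^ 2 * (lang_fps excursions - 1 - fps_X)"
proof -
  let ?E = "excursions - {[], [0]}"
  have fin: "finitary ?E"
    using finitary_subset[OF finitary_excursions] by auto
  have "lang_fps ({[]} \<union> ({[0]} \<union> ?E)) = 1 + (fps_X + lang_fps ?E)"
    using fin finitary_subset[OF finitary_excursions, of "{[0]} \<union> ?E"]
    by (subst lang_fps_Un | simp add: finitary_single lang_fps_single
        excursions_zero_Cons excursions_Nil)+
  moreover have "{[]} \<union> ({[0]} \<union> ?E) = excursions"
    by (auto simp: excursions_zero_Cons excursions_Nil)
  ultimately have E: "lang_fps ?E = lang_fps excursions - 1 - fps_X"
    by simp
  have "lang_fps (conc ?E {[- 1]}) = lang_fps ?E * fps_X"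
    using lang_fps_conc[OF fin finitary_single, of "[- 1]"]
    by (simp add: lang_fps_single inj_on_def)
  moreover have "lang_fps (conc {[1]} (conc ?E {[- 1]})) = fps_X * lang_fps (conc ?E {[- 1]})"
    using lang_fps_conc[OF finitary_single finitary_conc[OF fin finitary_single], of "[1]" "[- 1]"]
    by (simp add: lang_fps_single inj_on_def)
  ultimately show ?thesis
    by (simp add: arches_eq E power2_eq_square mult_ac)
qed

lemma lang_fps_arch_rests:
  "finitary arch_rests" "lang_fps arch_rests = 1 + fps_X + fps_X ^ 2 * lang_fps excursions"
proof -
  have fin: "finitary (conc {[0, 0]} excursions)"
    by (intro finitary_conc finitary_single finitary_excursions)
  show fin': "finitary arch_rests"
    by (rule finitary_subset[OF finitary_excursions]) (auto simp: arch_rests_eq)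
  have "lang_fps (conc {[0, 0]} excursions) = fps_X ^ 2 * lang_fps excursions"
    using lang_fps_conc[OF finitary_single finitary_excursions, of "[0, 0]"]
    by (simp add: lang_fps_single inj_on_def numeral_2_eq_2)
  moreover have "{[0]} \<inter> conc {[0, 0]} excursions = {}"
    by (auto simp: conc_def)
  then have "lang_fps ({[0]} \<union> conc {[0, 0]} excursions)
      = fps_X + lang_fps (conc {[0, 0]} excursions)"
    using lang_fps_Un[OF finitary_single fin, of "[0]"] lang_fps_single[of "[0]"] by simp
  moreover have disj: "{[]} \<inter> ({[0]} \<union> conc {[0, 0]} excursions) = {}"
    by (auto simp: conc_def)
  have sub: "{[0]} \<union> conc {[0, 0]} excursions \<subseteq> arch_rests"
    by (auto simp: arch_rests_def)
  have "lang_fps arch_rests = 1 + lang_fps ({[0]} \<union> conc {[0, 0]} excursions)"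
    using lang_fps_Un[OF finitary_single finitary_subset[OF fin' sub] disj]
      lang_fps_single[of "[]"]
    by (simp only: arch_rests_def list.size power_0)
  ultimately show "lang_fps arch_rests = 1 + fps_X + fps_X ^ 2 * lang_fps excursions"
    by simp
qed

lemma lang_fps_excursions:
  "lang_fps excursions = 1 + fps_X * lang_fps excursions
     + lang_fps arches * (1 + fps_X + fps_X ^ 2 * lang_fps excursions)"
proof -
  let ?Z = "conc {[0]} excursions" and ?A = "conc arches arch_rests"
  have finZ: "finitary ?Z" and finA: "finitary ?A"
    by (intro finitary_conc finitary_single finitary_excursions finitary_arches
        lang_fps_arch_rests)+
  have finU: "finitary (?Z \<union> ?A)"
    by (rule finitary_subset[OF finitary_excursions], subst (2) excursions_eq) auto
  \<comment> \<open>The first letter separates the summands of \<open>excursions_eq\<close>: none,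
    North, or the East step that opens an arch.\<close>
  have arch_hd: "\<exists>v. a = 1 # v" if "a \<in> arches" for a
    using that unfolding arches_eq conc_def by auto
  have "inj_on (\<lambda>(u, v). u @ v) (arches \<times> arch_rests)"
    by (rule inj_onI) (auto dest: arches_prefix_free)
  then have A: "lang_fps ?A = lang_fps arches * lang_fps arch_rests"
    by (intro lang_fps_conc finitary_arches lang_fps_arch_rests)
  have Z: "lang_fps ?Z = fps_X * lang_fps excursions"
    using lang_fps_conc[OF finitary_single finitary_excursions, of "[0]"]
    by (simp add: lang_fps_single inj_on_def)
  have "?Z \<inter> ?A = {}"
    using arch_hd by (fastforce simp: conc_def)
  then have "lang_fps (?Z \<union> ?A) = lang_fps ?Z + lang_fps ?A"
    by (rule lang_fps_Un[OF finZ finA])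
  moreover have "{[]} \<inter> (?Z \<union> ?A) = {}"
    using arch_hd by (fastforce simp: conc_def)
  then have "lang_fps ({[]} \<union> (?Z \<union> ?A)) = 1 + lang_fps (?Z \<union> ?A)"
    using lang_fps_Un[OF finitary_single finU] by (simp add: lang_fps_single)
  ultimately show ?thesis
    using excursions_eq A Z lang_fps_arch_rests(2) by (simp add: add.assoc)
qed

section \<open>Bubbles as arches\<close>

lemma last_trail: "last (trail c w) = trail c w ! length w"
  by (simp add: last_conv_nth)

lemma bubble_trail:
  assumes "w \<in> arches"
  shows "\<exists>r. bubble r (set (trail c w))"
proof -
  let ?cs = "trail c w" and ?S = "set (trail c w)"
  have adm: "admissible w" and sum: "sum_list w = 0" and len: "2 \<le> length w"
    and pos: "\<And>i. 0 < i \<Longrightarrow> i < length w \<Longrightarrow> 0 < sum_list (take i w)"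
    using assms by (auto simp: arches_def)
  have ip: "induced_path ?cs"
    using induced_path_trail[OF adm] .
  have listing: "pds_listing ?S ?cs"
    unfolding pds_listing_def
    using induced_path_snake[OF ip] induced_path_distinct[OF ip]
      trail_step_NEW[OF admissible_letters[OF adm]] by simp
  have col: "column c (?cs ! i) = sum_list (take i w) + 1" if "i \<le> length w" for i
    using fst_trail_nth[OF that, of c] by (simp add: column_def)
  have inner: "2 \<le> column c d" if d: "d \<in> ?S - {c, last ?cs}" for d
  proof -
    obtain i where i: "i < Suc (length w)" "d = ?cs ! i"
      using d by (auto simp: in_set_conv_nth)
    have "i \<noteq> 0"
      using d i by (metis DiffD2 hd_conv_nth hd_trail insertI1 trail_not_Nil)
    moreover have "i \<noteq> length w"
      using d i by (auto simp: last_trail)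
    ultimately show ?thesis
      using pos[of i] col[of i] i by simp
  qed
  \<comment> \<open>The width is the greatest column number reached; it is at least 2 because of the
    second cell.\<close>
  define m where "m = Max (column c ` ?S)"
  have max: "column c d \<le> m" if "d \<in> ?S" for d
    using that by (simp add: m_def)
  have "m \<in> column c ` ?S"
    unfolding m_def by (rule Max_in) auto
  then have attained: "\<exists>d\<in>?S. column c d = m"
    by auto
  have "?cs ! 1 \<in> ?S"
    using len by (intro nth_mem) auto
  then have "2 \<le> m"
    using max[of "?cs ! 1"] col[of 1] pos[of 1] len by simp
  moreover have "column c (last ?cs) = 1"
    using col[of "length w"] sum by (simp add: last_trail)
  ultimately have "bubble (nat m) ?S"
    unfolding bubble_def pds_def Let_def
    using listing inner max attained by (intro conjI exI[of _ ?cs]) auto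
  then show ?thesis
    by blast
qed

text \<open>Since a snake has no cycle, its listing has no chords and spells an admissible word; the
  column number of a cell is one more than the displacement of the prefix leading to it.\<close>

lemma bubble_is_trail:
  assumes "bubble r S"
  obtains c w where "w \<in> arches" "S = set (trail c w)"
proof -
  obtain cs where listing: "pds_listing S cs" and r: "2 \<le> r"
    and last: "column (hd cs) (last cs) = 1"
    and inner: "\<And>d. d \<in> S - {hd cs, last cs} \<Longrightarrow> 2 \<le> column (hd cs) d"
    and wide: "\<exists>d\<in>S. column (hd cs) d = int r"
    using assms unfolding bubble_def Let_def by blast
  have snake: "snake S" and S: "S = set cs" and dist: "distinct cs"
    and steps: "successively step_NEW cs"
    using listing by (auto simp: pds_listing_def)
  have ne: "cs \<noteq> []"
    using snake S by (auto simp: snake_def)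
  define c where "c = hd cs"
  obtain w where letters: "set w \<subseteq> {- 1, 0, 1}" and cs: "cs = trail c w"
    using trail_of_listing[OF steps ne] unfolding c_def by metis
  have "successively adjacent cs"
    using steps by (rule successively_mono) (auto simp: step_NEW_def adjacent_def)
  then have "induced_path cs"
    using induced_path_if_no_cycle dist ne snake S by (simp add: snake_def)
  then have adm: "admissible w"
    using admissible_if_induced_path letters cs by simp
  have col: "column c (cs ! i) = sum_list (take i w) + 1" if "i \<le> length w" for i
    using fst_trail_nth[OF that, of c] cs by (simp add: column_def)
  have last_nth: "last cs = cs ! length w"
    using cs by (simp add: last_trail)
  have sum: "sum_list w = 0"
    using last col[of "length w"] last_nth c_def by simp
  have nth0: "cs ! 0 = c"
    using ne by (simp add: c_def hd_conv_nth)
  have pos: "0 < sum_list (take i w)" if "0 < i" "i < length w" for i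
  proof -
    have len: "length cs = Suc (length w)"
      using cs by simp
    have "cs ! i \<noteq> cs ! 0" "cs ! i \<noteq> cs ! length w"
      using that len dist by (auto simp: nth_eq_iff_index_eq)
    then have "cs ! i \<in> S - {hd cs, last cs}"
      using that len S nth0 last_nth by (auto simp: c_def)
    then show ?thesis
      using inner[of "cs ! i"] col[of i] that by (simp add: c_def)
  qed
  \<comment> \<open>A word with at most one step and displacement zero visits only column 1, whereas
    some cell lies in column \<open>r\<close>, which is at least 2.\<close>
  have "2 \<le> length w"
  proof (rule ccontr)
    assume "\<not> 2 \<le> length w"
    obtain i where "i \<le> length w" "column c (cs ! i) = int r"
      using wide S cs unfolding c_def[symmetric] by (metis in_set_conv_nth length_trail less_Suc_eq_le)
    then have "sum_list (take i w) + 1 \<ge> 2"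
      using col[of i] r by simp
    moreover have "i = 0 \<or> i = length w"
      using \<open>\<not> 2 \<le> length w\<close> \<open>i \<le> length w\<close> by linarith
    ultimately show False
      using sum by auto
  qed
  then have "w \<in> arches"
    using adm sum pos by (simp add: arches_def)
  then show thesis
    using that S cs by blast
qed

text \<open>The tail of a bubble is the lower of the two cells in its leftmost column.\<close>

lemma trail_lex_min:
  assumes "w \<in> arches" "d \<in> set (trail c w)"
  shows "fst c < fst d \<or> (fst c = fst d \<and> snd c \<le> snd d)"
proof -
  obtain i where i: "i \<le> length w" "d = trail c w ! i"
    using assms(2) by (metis in_set_conv_nth length_trail less_Suc_eq_le)
  have "0 \<le> sum_list (take i w)"
    using assms(1) i by (cases "i = 0"; cases "i < length w") (auto simp: arches_def intro: less_imp_le)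
  then show ?thesis
    using fst_trail_nth[OF i(1), of c] i(2) trail_rows[OF assms(2)] by auto
qed

text \<open>The tail is the lexicographically least cell, so the set determines where the trail
  starts, and then by \<open>induced_path_unique\<close> the whole trail and its word.\<close>

lemma trail_set_unique:
  assumes "u \<in> arches" "w \<in> arches" "set (trail c u) = set (trail d w)"
  shows "u = w"
proof -
  have "c \<in> set (trail c u)" "d \<in> set (trail d w)"
    by (metis hd_in_set hd_trail trail_not_Nil)+
  then have "c = d"
    using trail_lex_min[OF assms(1), of d c] trail_lex_min[OF assms(2), of c d] assms(3)
    by (auto simp: prod_eq_iff)
  obtain cs ds where cs: "trail c u = c # cs" and ds: "trail c w = c # ds"
    by (metis hd_trail list.collapse trail_not_Nil)
  have "induced_path (c # cs)" "induced_path (c # ds)"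
    using induced_path_trail[of u c] induced_path_trail[of w c] assms cs ds by (auto simp: arches_def)
  then have "cs = ds"
    using induced_path_unique assms(3) \<open>c = d\<close> cs ds by metis
  then show ?thesis
    using trail_inj[of c u w] cs ds by simp
qed

text \<open>A trail with \<open>n\<close> steps has \<open>Suc n\<close> cells, and each translation
  class of bubbles contains exactly one trail of an arch that starts at the origin.\<close>

lemma bubble_count_Suc: "bubble_count (Suc n) = card {w \<in> arches. length w = n}"
proof -
  let ?A = "{w \<in> arches. length w = n}"
  let ?B = "{S. (\<exists>r. bubble r S) \<and> card S = Suc n}"
  define f where "f w = translation_rel `` {set (trail 0 w)}" for w
  have card_trail: "card (set (trail c w)) = Suc (length w)" if "w \<in> arches" for c w
    using distinct_card[OF induced_path_distinct[OF induced_path_trail[of w c]]] that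
    by (simp add: arches_def)
  have "?B // translation_rel = f ` ?A"
  proof (intro equalityI subsetI)
    fix X assume "X \<in> ?B // translation_rel"
    then obtain S r where S: "bubble r S" "card S = Suc n" and X: "X = translation_rel `` {S}"
      by (auto elim!: quotientE)
    obtain c w where w: "w \<in> arches" "S = set (trail c w)"
      using bubble_is_trail[OF S(1)] .
    have "S = (+) c ` set (trail 0 w)"
      using w(2) trail_translate[of c 0 w] by simp
    then have "(set (trail 0 w), S) \<in> translation_rel"
      unfolding translation_rel_def by blast
    then have "X = f w"
      unfolding X f_def using equiv_class_eq[OF equiv_translation_rel] by blast
    moreover have "length w = n"
      using card_trail[OF w(1), of c] S w by simp
    ultimately show "X \<in> f ` ?A"
      using w by blast
  next
    fix X assume "X \<in> f ` ?A"
    then obtain w where w: "w \<in> arches" "length w = n" "X = f w"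
      by auto
    then have "set (trail 0 w) \<in> ?B"
      using bubble_trail[OF w(1)] card_trail[OF w(1)] by auto
    then show "X \<in> ?B // translation_rel"
      unfolding w f_def by (rule quotientI)
  qed
  moreover have "inj_on f ?A"
  proof (rule inj_onI)
    fix u w assume uw: "u \<in> ?A" "w \<in> ?A" "f u = f w"
    then have "(set (trail 0 u), set (trail 0 w)) \<in> translation_rel"
      using eq_equiv_class[OF _ equiv_translation_rel] unfolding f_def by blast
    then obtain v where "set (trail 0 w) = (+) v ` set (trail 0 u)"
      by (auto simp: translation_rel_def)
    then have "set (trail 0 w) = set (trail v u)"
      using trail_translate[of v 0 u] by simp
    then show "u = w"
      using trail_set_unique uw by blast
  qed
  ultimately show ?thesis
    by (simp add: bubble_count_def card_image)
qed

lemma bubble_count_0: "bubble_count 0 = 0"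
proof -
  have "\<not> (bubble r S \<and> card S = 0)" for r S
    unfolding bubble_def pds_def pds_listing_def snake_def by auto
  then have none: "{S. (\<exists>r. bubble r S) \<and> card S = 0} = {}"
    by blast
  show ?thesis
    unfolding bubble_count_def none by simp
qed

lemma bubble_fps: "Abs_fps (\<lambda>n. real (bubble_count n)) = fps_X * lang_fps arches"
proof (rule fps_ext)
  fix n
  show "fps_nth (Abs_fps (\<lambda>n. real (bubble_count n))) n = fps_nth (fps_X * lang_fps arches) n"
    by (cases n) (simp_all add: bubble_count_0 bubble_count_Suc lang_fps_def)
qed

(* The constant term of the numerator is 0, so the division by 2 * q is exact. *)
theorem mainTheorem4:
  shows "Abs_fps (\<lambda>n. real (bubble_count n)) =
    (let q = (fps_X :: real fps) in
      (1 - q - q ^ 2 - q ^ 3 - q ^ 4 - q ^ 5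
        - fps_radical root 2
            ((1 + q) * (1 + q + q ^ 2) * (1 - q + q ^ 2) * (1 - q - q ^ 2) * (1 - 2 * q - q ^ 3)))
      / (2 * q))"
proof -
  define q where "q = (fps_X :: real fps)"
  define M where "M = lang_fps excursions"
  define F where "F = lang_fps arches"
  define B where "B = Abs_fps (\<lambda>n. real (bubble_count n))"
  define P where "P = 1 - q - q ^ 2 - q ^ 3 - q ^ 4 - q ^ 5"
  define D where
    "D = (1 + q) * (1 + q + q ^ 2) * (1 - q + q ^ 2) * (1 - q - q ^ 2) * (1 - 2 * q - q ^ 3)"
  have B: "B = q * F"
    using bubble_fps by (simp add: B_def q_def F_def)
  have F: "F = q ^ 2 * (M - 1 - q)"
    using lang_fps_arches by (simp add: F_def q_def M_def)
  have M: "M = 1 + q * M + F * (1 + q + q ^ 2 * M)"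
    using lang_fps_excursions by (simp add: F_def q_def M_def)
  \<comment> \<open>Multiply the equation \<open>M\<close> by \<open>q ^ 2\<close> and replace
    \<open>q ^ 2 * M\<close> by \<open>F + q ^ 2 + q ^ 3\<close>.\<close>
  have quad: "q ^ 2 * F ^ 2 - P * F + q ^ 4 = 0"
    using F M unfolding P_def by algebra
  \<comment> \<open>Completing the square in \<open>quad\<close> gives
    \<open>(P - 2 * q ^ 2 * F) ^ 2 = P ^ 2 - 4 * q ^ 6\<close>, and this difference of squares
    factors as \<open>D\<close>.\<close>
  have "(P - 2 * q * B) ^ 2 = D"
    using quad unfolding B D_def P_def by algebra
  \<comment> \<open>The constant term decides between the two square roots of
    \<open>D\<close>.\<close>
  moreover have "fps_nth (P - 2 * q * B) 0 = 1"
    by (simp add: P_def q_def fps_mult_nth_0 mult.assoc)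
  moreover have "fps_nth D 0 = 1"
    by (simp add: D_def q_def)
  ultimately have "P - 2 * q * B = fps_radical root 2 D"
    using fps_radical_root_2_unique by blast
  then have "P - fps_radical root 2 D = B * (2 * q)"
    by (simp add: algebra_simps)
  moreover have "2 * q \<noteq> 0"
    by (simp add: q_def)
  ultimately have "(P - fps_radical root 2 D) / (2 * q) = B"
    by (simp add: nonzero_mult_div_cancel_right)
  then show ?thesis
    by (simp add: Let_def B_def P_def D_def q_def)
qed

end
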